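(* Let $D$ be an infinite, connected, edge transitive, weakly descendant-homogeneous digraph of finite out-valency $m>1$ with property $Z$. Suppose that every alternet of $D$ is isomorphic to a fixed bipartite digraph $\Sigma\in\mathcal{C}$. Then $D$ is highly-arc-transitive.
   Context: Digraphs have no loops; subdigraphs are induced. An $s$-arc ($s\ge0$) from $u$ to $v$ is a sequence $u_0\dots u_s$ with $u_0=u$, $u_s=v$, $(u_i,u_{i+1})$ edges, and $u_{i-1}\ne u_{i+1}$ for $0<i<s$; $\mathrm{desc}(u)$ is the set of endpoints of arcs from $u$, $\mathrm{desc}(X)=\bigcup_{x\in X}\mathrm{desc}(x)$. Highly-arc-transitive: $\mathrm{Aut}(D)$ is transitive on $s$-arcs for every $s\ge0$. Edge transitive: $\mathrm{Aut}(D)$ transitive on edges. Weakly descendant-homogeneous: vertex transitive, and for finite vertex sets $X,Y$ and any isomorphism $f$ between the induced subdigraphs on $\mathrm{desc}(X)$, $\mathrm{desc}(Y)$ there is an automorphism agreeing with $f$ on $X$. Property $Z$: there is a surjection $f$ from vertices onto $\mathbb{Z}$ with $f(v)=f(u)+1$ for each edge $(u,v)$. Alternating walk: $x_0\dots x_n$ such that either $(x_{2i-1},x_{2i})$ and $(x_{2i+1},x_{2i})$ are edges for all relevant $i$, or $(x_{2i},x_{2i-1})$ and $(x_{2i},x_{2i+1})$ are edges for all relevant $i$. Edge $e$ reaches $e'$ if some alternating walk $x_0\dots x_n$ has $e=(x_0,x_1)$, $e'\in\{(x_{n-1},x_n),(x_n,x_{n-1})\}$. An alternet is the subdigraph spanned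 by an equivalence class of this relation; its sources/sinks are the tails/heads of its edges. $\delta(u,v)$ iff $u,v$ have the same set of out-neighbours. Class $\mathcal{C}$: bipartite digraphs with parts $X$ (sources), $Y$ (sinks), all edges from $X$ to $Y$, no isolated vertices, $X,Y$ finite non-empty, edge transitive, $\delta$ non-trivial on $X$, and $|Y|$ equal to the size of the $\delta$-classes in $X$. *)

theory Defs
  imports "Graph_Theory.Pair_Digraph" "Graph_Theory.Digraph_Component" "Graph_Theory.Digraph_Isomorphism"
begin

text \<open>
  Digraphs have no parallel edges and may be infinite: they are values of type
  \<^typ>\<open>'a pair_pre_digraph\<close> satisfying \<^const>\<open>pair_loopfree_digraph\<close>. Connectedness
  (of the underlying undirected graph), induced subdigraphs \<open>D \<restriction> S\<close>, out-valency and
  the relation of being isomorphic are those of the library.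
\<close>

text \<open>
  Isomorphisms as vertex maps. Only the values on the vertices matter. For digraphs without
  parallel edges this agrees with \<^const>\<open>digraph_iso\<close>; see \<open>digraph_iso_iff_vertex_iso\<close> below.
\<close>
definition vertex_iso ::
    "('a \<Rightarrow> 'c) \<Rightarrow> ('a, 'b) pre_digraph \<Rightarrow> ('c, 'd) pre_digraph \<Rightarrow> bool" where
  "vertex_iso f G H \<longleftrightarrow> bij_betw f (verts G) (verts H) \<and>
     (\<forall>u\<in>verts G. \<forall>v\<in>verts G. u \<rightarrow>\<^bsub>G\<^esub> v \<longleftrightarrow> f u \<rightarrow>\<^bsub>H\<^esub> f v)"

definition automorphism :: "('a \<Rightarrow> 'a) \<Rightarrow> 'a pair_pre_digraph \<Rightarrow> bool" where
  "automorphism g D \<longleftrightarrow> vertex_iso g D D"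

definition vertex_transitive :: "'a pair_pre_digraph \<Rightarrow> bool" where
  "vertex_transitive D \<longleftrightarrow>
     (\<forall>u\<in>pverts D. \<forall>v\<in>pverts D. \<exists>g. automorphism g D \<and> g u = v)"

definition edge_transitive :: "'a pair_pre_digraph \<Rightarrow> bool" where
  "edge_transitive D \<longleftrightarrow>
     (\<forall>e\<in>parcs D. \<forall>e'\<in>parcs D. \<exists>g. automorphism g D \<and> map_prod g g e = e')"

text \<open>The \<open>s\<close>-arc \<open>u\<^sub>0 \<dots> u\<^sub>s\<close> is the list of its \<open>s + 1\<close> vertices.\<close>
definition s_arc :: "'a pair_pre_digraph \<Rightarrow> nat \<Rightarrow> 'a list \<Rightarrow> bool" where
  "s_arc D s us \<longleftrightarrow> length us = Suc s \<and> set us \<subseteq> pverts D \<and>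
     (\<forall>i<s. (us ! i, us ! (i + 1)) \<in> parcs D) \<and>
     (\<forall>i. 0 < i \<and> i < s \<longrightarrow> us ! (i - 1) \<noteq> us ! (i + 1))"

definition highly_arc_transitive :: "'a pair_pre_digraph \<Rightarrow> bool" where
  "highly_arc_transitive D \<longleftrightarrow>
     (\<forall>s us vs. s_arc D s us \<and> s_arc D s vs \<longrightarrow> (\<exists>g. automorphism g D \<and> map g us = vs))"

definition desc :: "'a pair_pre_digraph \<Rightarrow> 'a \<Rightarrow> 'a set" where
  "desc D u = {v. \<exists>s us. s_arc D s us \<and> us ! 0 = u \<and> us ! s = v}"

definition desc_set :: "'a pair_pre_digraph \<Rightarrow> 'a set \<Rightarrow> 'a set" where
  "desc_set D X = (\<Union>x\<in>X. desc D x)"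

definition weakly_descendant_homogeneous :: "'a pair_pre_digraph \<Rightarrow> bool" where
  "weakly_descendant_homogeneous D \<longleftrightarrow> vertex_transitive D \<and>
     (\<forall>X Y f. finite X \<and> X \<subseteq> pverts D \<and> finite Y \<and> Y \<subseteq> pverts D \<and>
        vertex_iso f (D \<restriction> desc_set D X) (D \<restriction> desc_set D Y) \<longrightarrow>
        (\<exists>g. automorphism g D \<and> (\<forall>x\<in>X. g x = f x)))"

definition property_Z :: "'a pair_pre_digraph \<Rightarrow> bool" where
  "property_Z D \<longleftrightarrow>
     (\<exists>f :: 'a \<Rightarrow> int. f ` pverts D = UNIV \<and> (\<forall>(u, v)\<in>parcs D. f v = f u + 1))"

text \<open>The walk \<open>x\<^sub>0 \<dots> x\<^sub>n\<close> is a list of length \<open>n + 1\<close>; an index \<open>i\<close> is relevant for an edge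
  if both of its ends exist in the list.\<close>
definition alternating_walk :: "'a pair_pre_digraph \<Rightarrow> 'a list \<Rightarrow> bool" where
  "alternating_walk D xs \<longleftrightarrow> xs \<noteq> [] \<and> set xs \<subseteq> pverts D \<and>
     ((\<forall>i. (0 < i \<and> 2 * i < length xs \<longrightarrow> (xs ! (2 * i - 1), xs ! (2 * i)) \<in> parcs D) \<and>
           (2 * i + 1 < length xs \<longrightarrow> (xs ! (2 * i + 1), xs ! (2 * i)) \<in> parcs D)) \<or>
      (\<forall>i. (0 < i \<and> 2 * i < length xs \<longrightarrow> (xs ! (2 * i), xs ! (2 * i - 1)) \<in> parcs D) \<and>
           (2 * i + 1 < length xs \<longrightarrow> (xs ! (2 * i), xs ! (2 * i + 1)) \<in> parcs D)))"

definition reaches :: "'a pair_pre_digraph \<Rightarrow> ('a \<times> 'a) rel" where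
  "reaches D = {(e, e'). e \<in> parcs D \<and> e' \<in> parcs D \<and>
     (\<exists>xs n. alternating_walk D xs \<and> length xs = n + 1 \<and> 0 < n \<and> e = (xs ! 0, xs ! 1) \<and>
        e' \<in> {(xs ! (n - 1), xs ! n), (xs ! n, xs ! (n - 1))})}"

text \<open>
  Subdigraphs are induced, so an alternet is the induced subdigraph on the ends of the edges of
  a class. If \<open>D\<close> has property \<open>Z\<close> its edges are exactly those of the class; see
  \<open>arcs_alternet\<close> below.
\<close>
definition alternets :: "'a pair_pre_digraph \<Rightarrow> ('a, 'a \<times> 'a) pre_digraph set" where
  "alternets D = {D \<restriction> (fst ` A \<union> snd ` A) | A. A \<in> parcs D // reaches D}"

definition delta :: "'a pair_pre_digraph \<Rightarrow> 'a \<Rightarrow> 'a \<Rightarrow> bool" where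
  "delta D u v \<longleftrightarrow> parcs D `` {u} = parcs D `` {v}"

definition class_C :: "'a pair_pre_digraph set" where
  "class_C = {S. pair_loopfree_digraph S \<and> edge_transitive S \<and>
     (\<forall>v\<in>pverts S. \<exists>e\<in>parcs S. v = fst e \<or> v = snd e) \<and>
     (\<exists>X Y. pverts S = X \<union> Y \<and> X \<inter> Y = {} \<and> parcs S \<subseteq> X \<times> Y \<and>
        finite X \<and> X \<noteq> {} \<and> finite Y \<and> Y \<noteq> {} \<and>
        (\<exists>u\<in>X. \<exists>v\<in>X. u \<noteq> v \<and> delta S u v) \<and>
        (\<forall>u\<in>X. card {v \<in> X. delta S u v} = card Y))}"


lemma digraph_iso_iff_vertex_iso:
  assumes "nomulti_digraph G" "nomulti_digraph H"
  shows "digraph_iso G H \<longleftrightarrow> (\<exists>f. vertex_iso f G H)"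
proof
  interpret G: nomulti_digraph G by fact
  assume "digraph_iso G H"
  then obtain h where h: "pre_digraph.digraph_isomorphism G h" and H: "H = app_iso h G"
    unfolding digraph_iso_def by blast
  have inj: "inj_on (iso_verts h) (verts G)"
    and th: "\<And>a. a \<in> arcs G \<Longrightarrow> iso_tail h (iso_arcs h a) = iso_verts h (tail G a)"
            "\<And>a. a \<in> arcs G \<Longrightarrow> iso_head h (iso_arcs h a) = iso_verts h (head G a)"
    using h by (auto simp: G.digraph_isomorphism_def)
  have "u \<rightarrow>\<^bsub>G\<^esub> v \<longleftrightarrow> iso_verts h u \<rightarrow>\<^bsub>H\<^esub> iso_verts h v"
    if u: "u \<in> verts G" and v: "v \<in> verts G" for u v
  proof
    assume "u \<rightarrow>\<^bsub>G\<^esub> v"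
    then obtain a where "a \<in> arcs G" "tail G a = u" "head G a = v" by blast
    then show "iso_verts h u \<rightarrow>\<^bsub>H\<^esub> iso_verts h v"
      using th by (force simp: H arcs_ends_conv)
  next
    assume "iso_verts h u \<rightarrow>\<^bsub>H\<^esub> iso_verts h v"
    then obtain a where a: "a \<in> arcs G" "iso_verts h (tail G a) = iso_verts h u"
        "iso_verts h (head G a) = iso_verts h v"
      using th by (auto simp: H arcs_ends_conv)
    then have "tail G a = u" "head G a = v"
      using inj u v by (auto dest: inj_onD)
    then show "u \<rightarrow>\<^bsub>G\<^esub> v" using a(1) by (auto simp: arcs_ends_conv)
  qed
  then have "vertex_iso (iso_verts h) G H"
    using inj by (auto simp: vertex_iso_def bij_betw_def H)
  then show "\<exists>f. vertex_iso f G H" by blast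
next
  interpret G: nomulti_digraph G by fact
  interpret H: nomulti_digraph H by fact
  assume "\<exists>f. vertex_iso f G H"
  then obtain f where inj: "inj_on f (verts G)" and im: "f ` verts G = verts H"
    and e: "\<And>u v. u \<in> verts G \<Longrightarrow> v \<in> verts G \<Longrightarrow> u \<rightarrow>\<^bsub>G\<^esub> v \<longleftrightarrow> f u \<rightarrow>\<^bsub>H\<^esub> f v"
    unfolding vertex_iso_def bij_betw_def by blast
  have "\<forall>a\<in>arcs G. \<exists>b. b \<in> arcs H \<and> tail H b = f (tail G a) \<and> head H b = f (head G a)"
  proof
    fix a assume a: "a \<in> arcs G"
    then have "tail G a \<rightarrow>\<^bsub>G\<^esub> head G a" by (auto simp: arcs_ends_conv)
    then have "f (tail G a) \<rightarrow>\<^bsub>H\<^esub> f (head G a)" using e a by simp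
    then show "\<exists>b. b \<in> arcs H \<and> tail H b = f (tail G a) \<and> head H b = f (head G a)" by blast
  qed
  then obtain k where k: "\<And>a. a \<in> arcs G \<Longrightarrow>
      k a \<in> arcs H \<and> tail H (k a) = f (tail G a) \<and> head H (k a) = f (head G a)" by metis
  have injk: "inj_on k (arcs G)"
  proof (rule inj_onI)
    fix a b assume ab: "a \<in> arcs G" "b \<in> arcs G" "k a = k b"
    then have "tail G a = tail G b" "head G a = head G b"
      using k inj by (metis G.tail_in_verts inj_onD, metis k inj G.head_in_verts inj_onD)
    then show "a = b" using ab G.no_multi_arcs by (simp add: arc_to_ends_def)
  qed
  have imk: "k ` arcs G = arcs H"
  proof
    show "k ` arcs G \<subseteq> arcs H" using k by blast
    show "arcs H \<subseteq> k ` arcs G"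
    proof
      fix b assume b: "b \<in> arcs H"
      then obtain u v where uv: "u \<in> verts G" "v \<in> verts G" "tail H b = f u" "head H b = f v"
        by (metis H.tail_in_verts H.head_in_verts im imageE)
      have "f u \<rightarrow>\<^bsub>H\<^esub> f v" using b uv by (force simp: arcs_ends_conv)
      then have "u \<rightarrow>\<^bsub>G\<^esub> v" using e uv by blast
      then obtain a where a: "a \<in> arcs G" "tail G a = u" "head G a = v" by blast
      then have "k a = b" using k[OF a(1)] b uv H.no_multi_arcs by (simp add: arc_to_ends_def)
      then show "b \<in> k ` arcs G" using a by blast
    qed
  qed
  let ?h = "\<lparr>iso_verts = f, iso_arcs = k, iso_head = head H, iso_tail = tail H\<rparr>"
  have "G.digraph_isomorphism ?h"
    unfolding G.digraph_isomorphism_def using inj injk k G.wf_digraph by simp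
  moreover have "H = app_iso ?h G"
    by (rule pre_digraph.equality) (simp_all add: im imk)
  ultimately show "digraph_iso G H" unfolding digraph_iso_def by blast
qed

lemma alternating_walk_levels:
  fixes f :: "'a \<Rightarrow> int"
  assumes f': "\<forall>(u, v)\<in>parcs D. f v = f u + 1"
    and w: "alternating_walk D xs" and e: "(xs ! 0, xs ! 1) \<in> parcs D" and l: "1 < length xs"
  shows "j < length xs \<Longrightarrow> f (xs ! j) = f (xs ! 0) + (if even j then 0 else 1)"
    and "Suc j < length xs \<Longrightarrow>
      (if even j then (xs ! j, xs ! Suc j) else (xs ! Suc j, xs ! j)) \<in> parcs D"
proof -
  have f: "f v = f u + 1" if "(u, v) \<in> parcs D" for u v using bspec[OF f' that] by simp
  have "(xs ! 1, xs ! 0) \<notin> parcs D" using f[OF e] f[of "xs ! 1" "xs ! 0"] by auto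
  with w l have alt: "\<forall>i. (0 < i \<and> 2 * i < length xs \<longrightarrow> (xs ! (2 * i), xs ! (2 * i - 1)) \<in> parcs D) \<and>
      (2 * i + 1 < length xs \<longrightarrow> (xs ! (2 * i), xs ! (2 * i + 1)) \<in> parcs D)"
    unfolding alternating_walk_def by (elim conjE disjE) (drule spec[of _ 0], simp, assumption)
  have s: "0 < i \<Longrightarrow> 2 * i < length xs \<Longrightarrow> (xs ! (2 * i), xs ! (2 * i - 1)) \<in> parcs D"
     "2 * i + 1 < length xs \<Longrightarrow> (xs ! (2 * i), xs ! (2 * i + 1)) \<in> parcs D" for i
    using spec[OF alt, of i] by simp_all
  show st: "(if even j then (xs ! j, xs ! Suc j) else (xs ! Suc j, xs ! j)) \<in> parcs D"
    if "Suc j < length xs" for j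
  proof (cases "even j")
    case True
    then obtain i where "j = 2 * i" by blast
    then show ?thesis using s(2)[of i] that by simp
  next
    case False
    then obtain i where "j = 2 * i + 1" by (blast elim: oddE)
    then show ?thesis using s(1)[of "Suc i"] that by simp
  qed
  show "f (xs ! j) = f (xs ! 0) + (if even j then 0 else 1)" if "j < length xs" for j
    using that
  proof (induction j)
    case (Suc j)
    then show ?case using st[of j] f[of "xs ! j" "xs ! Suc j"] f[of "xs ! Suc j" "xs ! j"]
      by (auto split: if_splits)
  qed simp
qed

lemma alternating_walkI:
  assumes "xs \<noteq> []" "set xs \<subseteq> pverts D"
    and st: "\<And>j. Suc j < length xs \<Longrightarrow>
      (if even j then (xs ! j, xs ! Suc j) else (xs ! Suc j, xs ! j)) \<in> parcs D"
  shows "alternating_walk D xs"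
proof -
  have "(xs ! (2 * i), xs ! (2 * i - 1)) \<in> parcs D" if "0 < i" "2 * i < length xs" for i
    using st[of "2 * i - 1"] that by (auto split: if_splits)
  moreover have "(xs ! (2 * i), xs ! (2 * i + 1)) \<in> parcs D" if "2 * i + 1 < length xs" for i
    using st[of "2 * i"] that by auto
  ultimately show ?thesis using assms(1,2) unfolding alternating_walk_def by blast
qed

lemma arcs_alternet:
  assumes D: "pair_wf_digraph D" and Z: "property_Z D" and A: "A \<in> parcs D // reaches D"
  shows "arcs (D \<restriction> (fst ` A \<union> snd ` A)) = A"
proof
  interpret pair_wf_digraph D by fact
  obtain f :: "'a \<Rightarrow> int" where f': "\<forall>(u, v)\<in>parcs D. f v = f u + 1"
    using Z unfolding property_Z_def by (elim exE conjE) (rule that)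
  have f: "f v = f u + 1" if "(u, v) \<in> parcs D" for u v using bspec[OF f' that] by simp
  obtain d where d: "d \<in> parcs D" and Ad: "A = reaches D `` {d}"
    using A by (elim quotientE) (rule that)
  show "A \<subseteq> arcs (D \<restriction> (fst ` A \<union> snd ` A))"
    unfolding Ad reaches_def by (force simp: induce_subgraph_def)
  have lev: "f (fst e) = f (fst d)" "f (snd e) = f (fst d) + 1" if eA: "e \<in> A" for e
  proof -
    obtain xs n where w: "alternating_walk D xs" "length xs = n + 1" "0 < n"
      "d = (xs ! 0, xs ! 1)" and e: "e \<in> {(xs ! (n - 1), xs ! n), (xs ! n, xs ! (n - 1))}"
      and ep: "e \<in> parcs D"
      using eA unfolding Ad reaches_def by blast
    have "f (xs ! n) = f (fst d) + (if even n then 0 else 1)"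
         "f (xs ! (n - 1)) = f (fst d) + (if even (n - 1) then 0 else 1)"
      using alternating_walk_levels(1)[OF f' w(1), of n]
        alternating_walk_levels(1)[OF f' w(1), of "n - 1"] w(2-4) d by simp_all
    moreover have "f (snd e) = f (fst e) + 1" using ep f[of "fst e" "snd e"] by simp
    ultimately show "f (fst e) = f (fst d)" "f (snd e) = f (fst d) + 1"
      using e \<open>0 < n\<close> by (auto split: if_splits)
  qed
  show "arcs (D \<restriction> (fst ` A \<union> snd ` A)) \<subseteq> A"
  proof
    fix e assume "e \<in> arcs (D \<restriction> (fst ` A \<union> snd ` A))"
    then obtain x y where xy: "e = (x, y)" "(x, y) \<in> parcs D"
      "x \<in> fst ` A \<union> snd ` A" "y \<in> fst ` A \<union> snd ` A"
      by (cases e) (auto simp: induce_subgraph_def)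
    have fx: "f y = f x + 1" using f xy(2) .
    have xA: "x \<in> fst ` A"
    proof (rule ccontr)
      assume "x \<notin> fst ` A"
      then have "x \<in> snd ` A" using xy(3) by blast
      then have "f x = f (fst d) + 1" using lev(2) by blast
      moreover have "f y = f (fst d) \<or> f y = f (fst d) + 1" using xy(4) lev by blast
      ultimately show False using fx by auto
    qed
    obtain y' where e': "(x, y') \<in> A" using xA by force
    then obtain xs n where w: "alternating_walk D xs" "length xs = n + 1" "0 < n"
      "d = (xs ! 0, xs ! 1)" and e: "(x, y') \<in> {(xs ! (n - 1), xs ! n), (xs ! n, xs ! (n - 1))}"
      and ep: "(x, y') \<in> parcs D"
      unfolding Ad reaches_def by blast
    have d': "(xs ! 0, xs ! 1) \<in> parcs D" and l: "1 < length xs" using w d by auto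
    note lv = alternating_walk_levels(1)[OF f' w(1) d' l]
    note st = alternating_walk_levels(2)[OF f' w(1) d' l]
    have fx0: "f x = f (xs ! 0)" using lev(1)[OF e'] w(4) by simp
    have sub: "set xs \<subseteq> pverts D" using w(1) by (simp add: alternating_walk_def)
    have xv: "x \<in> pverts D" "y \<in> pverts D" using xy(2) wellformed' by blast+
    have "\<exists>zs m. alternating_walk D zs \<and> length zs = m + 1 \<and> 0 < m \<and> d = (zs ! 0, zs ! 1) \<and>
        (x, y) = (zs ! (m - 1), zs ! m)"
    proof (cases "even n")
      case True
      have "(x, y') = (xs ! n, xs ! (n - 1))"
        using e lv[of n] f[OF ep] fx0 True w(2) by auto
      then have xn: "xs ! n = x" by simp
      let ?z = "xs @ [y]"
      have "alternating_walk D ?z"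
      proof (rule alternating_walkI)
        fix j assume "Suc j < length ?z"
        then consider "Suc j < length xs" | "j = n" using w(2) by fastforce
        then show "(if even j then (?z ! j, ?z ! Suc j) else (?z ! Suc j, ?z ! j)) \<in> parcs D"
          using st[of j] True xy(2) xn w by cases (auto simp: nth_append)
      qed (use sub xv in auto)
      moreover have "d = (?z ! 0, ?z ! 1)" using w by (auto simp: nth_append)
      moreover have "(x, y) = (?z ! (n + 1 - 1), ?z ! (n + 1))" using xn w by (auto simp: nth_append)
      ultimately show ?thesis using w(2) by (intro exI[of _ ?z] exI[of _ "n + 1"]) auto
    next
      case False
      have "(x, y') = (xs ! (n - 1), xs ! n)"
        using e lv[of n] f[OF ep] fx0 False w(2) by auto
      then have xn: "xs ! n = y'" by simp
      let ?z = "xs @ [x, y]"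
      have "alternating_walk D ?z"
      proof (rule alternating_walkI)
        fix j assume "Suc j < length ?z"
        then consider "Suc j < length xs" | "j = n" | "j = Suc n" using w(2) by fastforce
        then show "(if even j then (?z ! j, ?z ! Suc j) else (?z ! Suc j, ?z ! j)) \<in> parcs D"
          using st[of j] False xy(2) ep xn w by cases (auto simp: nth_append)
      qed (use sub xv in auto)
      moreover have "d = (?z ! 0, ?z ! 1)" using w by (auto simp: nth_append)
      moreover have "(x, y) = (?z ! (n + 2 - 1), ?z ! (n + 2))" using w by (auto simp: nth_append)
      ultimately show ?thesis using w(2) by (intro exI[of _ ?z] exI[of _ "n + 2"]) auto
    qed
    then show "e \<in> A" using d xy unfolding Ad reaches_def by blast
  qed
qed

end

theory Submission
  imports Defs
begin

text \<open>
  Let \<open>x\<close>, \<open>y\<close> be distinct out-neighbours of \<open>u\<close> and let \<open>x'\<close> be \<open>\<delta>\<close>-equivalent to \<open>x\<close>. Exchanging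
  \<open>x\<close> for \<open>x'\<close> and fixing everything else is an isomorphism from \<open>desc {x, y}\<close> to \<open>desc {x', y}\<close>,
  so some automorphism fixes \<open>y\<close> and sends \<open>x\<close> to \<open>x'\<close>. Hence \<open>x'\<close> is a sink of the alternet that
  has \<open>x\<close> and \<open>y\<close> as sinks. As \<open>\<delta>\<close>-classes and sets of sinks have the same finite size, they
  coincide, so any two out-neighbours of a vertex are \<open>\<delta>\<close>-equivalent. Then \<open>desc v\<close> consists of
  levels, each completely joined to the next, and any level-preserving permutation of \<open>desc v\<close> is
  an automorphism of it; one such permutation exchanges two given arcs from \<open>v\<close>.
\<close>

section \<open>Induced subdigraphs and automorphisms in terms of edge sets\<close>

lemma dominates_induce_iff:
  "u \<rightarrow>\<^bsub>D \<restriction> S\<^esub> v \<longleftrightarrow> (u, v) \<in> parcs D \<and> u \<in> S \<and> v \<in> S"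
  for D :: "'a pair_pre_digraph"
  by (auto simp: arcs_ends_conv induce_subgraph_def)

text \<open>The vertex set of \<open>D \<restriction> S\<close> is \<open>S\<close> itself, not its
  intersection with \<open>pverts D\<close>; hence the form without side conditions.\<close>

lemma vertex_iso_induce_iff:
  "vertex_iso f (D \<restriction> S) (D \<restriction> T) \<longleftrightarrow> bij_betw f S T \<and>
     (\<forall>u\<in>S. \<forall>v\<in>S. (u, v) \<in> parcs D \<longleftrightarrow> (f u, f v) \<in> parcs D)"
  for D :: "'a pair_pre_digraph"
  unfolding vertex_iso_def dominates_induce_iff
  by (auto simp: bij_betw_def)

lemma automorphism_iff:
  "automorphism g D \<longleftrightarrow> bij_betw g (pverts D) (pverts D) \<and>
     (\<forall>u\<in>pverts D. \<forall>v\<in>pverts D. (u, v) \<in> parcs D \<longleftrightarrow> (g u, g v) \<in> parcs D)"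
  unfolding automorphism_def vertex_iso_def by (auto simp: arcs_ends_conv)

lemma automorphism_comp:
  assumes "automorphism g D" "automorphism h D"
  shows "automorphism (h \<circ> g) D"
  using assms unfolding automorphism_iff
  by (auto intro: bij_betw_trans dest: bij_betwE)

lemma automorphism_map_s_arc:
  assumes g: "automorphism g D" and us: "s_arc D s us"
  shows "s_arc D s (map g us)"
proof -
  have sub: "set us \<subseteq> pverts D" and len: "length us = Suc s" using us by (auto simp: s_arc_def)
  have nth: "us ! i \<in> pverts D" if "i \<le> s" for i using that sub len by (auto simp: subset_iff)
  have inj: "inj_on g (pverts D)" using g by (auto simp: automorphism_iff bij_betw_def)
  show ?thesis
    unfolding s_arc_def
  proof (intro conjI allI impI)
    show "set (map g us) \<subseteq> pverts D" using sub g by (auto simp: automorphism_iff dest: bij_betwE)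
  next
    fix i assume "i < s"
    then show "(map g us ! i, map g us ! (i + 1)) \<in> parcs D"
      using us g nth[of i] nth[of "i + 1"] len by (auto simp: automorphism_iff s_arc_def)
  next
    fix i assume i: "0 < i \<and> i < s"
    then have "us ! (i - 1) \<noteq> us ! (i + 1)" using us by (auto simp: s_arc_def)
    then have "g (us ! (i - 1)) \<noteq> g (us ! (i + 1))"
      using inj_onD[OF inj] nth[of "i - 1"] nth[of "i + 1"] i by auto
    then show "map g us ! (i - 1) \<noteq> map g us ! (i + 1)" using i len by (simp add: nth_map less_imp_diff_less)
  qed (use len in simp)
qed

section \<open>Arcs and descendants in a digraph with a level function\<close>

locale levelled_digraph = pair_wf_digraph D for D :: "'a pair_pre_digraph" +
  fixes lev :: "'a \<Rightarrow> int"
  assumes lev_arc: "(u, v) \<in> parcs D \<Longrightarrow> lev v = lev u + 1"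
begin

lemma arc_verts: "(u, v) \<in> parcs D \<Longrightarrow> u \<in> pverts D \<and> v \<in> pverts D"
  using wellformed' by blast

text \<open>Two consecutive edges raise the level by 2, so their outer ends differ: every directed
  walk is an arc.\<close>

lemma s_arc_iff:
  "s_arc D s us \<longleftrightarrow> length us = Suc s \<and> set us \<subseteq> pverts D \<and>
     (\<forall>i<s. (us ! i, us ! Suc i) \<in> parcs D)"
proof -
  have "us ! (i - 1) \<noteq> us ! (i + 1)"
    if e: "\<forall>i<s. (us ! i, us ! Suc i) \<in> parcs D" and i: "0 < i" "i < s" for i
  proof -
    obtain j where j: "i = Suc j" using i(1) gr0_implies_Suc by blast
    have "lev (us ! Suc (Suc j)) = lev (us ! j) + 2"
      using lev_arc[of "us ! j" "us ! Suc j"] lev_arc[of "us ! Suc j" "us ! Suc (Suc j)"] e i j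
      by simp
    then show ?thesis using j by auto
  qed
  then show ?thesis unfolding s_arc_def by auto
qed

lemma s_arc_snoc:
  assumes us: "s_arc D s us" and e: "(us ! s, w) \<in> parcs D"
  shows "s_arc D (Suc s) (us @ [w])"
  using us e arc_verts[OF e] unfolding s_arc_iff
  by (auto simp: nth_append less_Suc_eq)

lemma s_arc_reachable:
  assumes us: "s_arc D s us"
  shows "i \<le> s \<Longrightarrow> (us ! 0, us ! i) \<in> (parcs D)\<^sup>* \<and> lev (us ! i) = lev (us ! 0) + int i"
proof (induction i)
  case (Suc i)
  then have "(us ! i, us ! Suc i) \<in> parcs D" using us by (auto simp: s_arc_iff)
  then show ?case using Suc lev_arc by (auto intro: rtrancl_into_rtrancl)
qed simp

text \<open>Directed walks being arcs, descent is reachability. The arc of length 0 is the reason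
  for asking that \<open>u\<close> be a vertex.\<close>

lemma desc_eq_rtrancl:
  assumes u: "u \<in> pverts D"
  shows "desc D u = (parcs D)\<^sup>* `` {u}"
proof
  show "desc D u \<subseteq> (parcs D)\<^sup>* `` {u}"
    unfolding desc_def using s_arc_reachable by blast
  show "(parcs D)\<^sup>* `` {u} \<subseteq> desc D u"
  proof
    fix w assume "w \<in> (parcs D)\<^sup>* `` {u}"
    then have "(u, w) \<in> (parcs D)\<^sup>*" by simp
    then show "w \<in> desc D u"
    proof induction
      case base
      have "s_arc D 0 [u]" using u by (simp add: s_arc_iff)
      then show ?case unfolding desc_def by force
    next
      case (step y z)
      then obtain s us where us: "s_arc D s us" "us ! 0 = u" "us ! s = y"
        unfolding desc_def by blast
      have "s_arc D (Suc s) (us @ [z])" using s_arc_snoc us step.hyps by blast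
      moreover have "(us @ [z]) ! 0 = u" "(us @ [z]) ! Suc s = z"
        using us by (auto simp: s_arc_iff nth_append)
      ultimately show ?case unfolding desc_def by blast
    qed
  qed
qed

lemma reachable_lev:
  "(u, w) \<in> (parcs D)\<^sup>* \<Longrightarrow> w = u \<or> lev u < lev w"
  by (induction rule: rtrancl_induct) (auto dest: lev_arc)

text \<open>An arc lies among the descendants of its first vertex. Weak homogeneity, applied to the
  vertex set of an arc, thus asks for an isomorphism between descendant sets of single vertices and
  yet controls the whole arc.\<close>

lemma desc_set_s_arc:
  assumes us: "s_arc D s us"
  shows "desc_set D (set us) = (parcs D)\<^sup>* `` {us ! 0}"
proof
  have sub: "set us \<subseteq> pverts D" and len: "length us = Suc s" using us by (auto simp: s_arc_def)
  show "desc_set D (set us) \<subseteq> (parcs D)\<^sup>* `` {us ! 0}"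
  proof
    fix w assume "w \<in> desc_set D (set us)"
    then obtain i where i: "i \<le> s" "w \<in> desc D (us ! i)"
      unfolding desc_set_def using len by (auto simp: in_set_conv_nth less_Suc_eq_le)
    then have "(us ! i, w) \<in> (parcs D)\<^sup>*"
      using desc_eq_rtrancl[of "us ! i"] sub len by (auto simp: subset_iff)
    then show "w \<in> (parcs D)\<^sup>* `` {us ! 0}"
      using s_arc_reachable[OF us i(1)] by (auto intro: rtrancl_trans)
  qed
  have "us ! 0 \<in> set us" using len by simp
  then show "(parcs D)\<^sup>* `` {us ! 0} \<subseteq> desc_set D (set us)"
    unfolding desc_set_def using desc_eq_rtrancl[of "us ! 0"] sub by auto
qed

section \<open>Exchanging equivalent vertices\<close>

lemma delta_lev_eq:
  assumes "delta D x x'" "(x, w) \<in> parcs D"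
  shows "lev x' = lev x"
proof -
  have "(x', w) \<in> parcs D" using assms by (auto simp: delta_def)
  then show ?thesis using lev_arc[OF assms(2)] lev_arc[of x' w] by simp
qed

text \<open>The vertices \<open>x\<close> and \<open>x'\<close> have the same proper descendants,
  and they receive no edge from either descendant set, since nothing there lies on a lower level. So
  the map that moves only \<open>x\<close> respects edges.\<close>

lemma delta_exchange:
  assumes wdh: "weakly_descendant_homogeneous D"
    and d: "delta D x x'" and w: "(x, w) \<in> parcs D" and y: "y \<in> pverts D" "lev y = lev x"
    and ne: "x \<noteq> y" "x' \<noteq> y"
  obtains g where "automorphism g D" "g x = x'" "g y = y"
proof -
  have N: "(x, v) \<in> parcs D \<longleftrightarrow> (x', v) \<in> parcs D" for v using d by (auto simp: delta_def)
  have lx: "lev x' = lev x" using delta_lev_eq[OF d w] .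
  have xv: "x \<in> pverts D" "x' \<in> pverts D" using w N arc_verts by blast+
  define P where "P = (parcs D)\<^sup>+ `` {x}"
  have P': "P = (parcs D)\<^sup>+ `` {x'}"
    unfolding P_def by (auto simp: trancl_unfold_left N)
  \<comment> \<open>\<open>R\<close> is what the two descendant sets share; one adds
    \<open>x\<close> to it, the other \<open>x'\<close>.\<close>
  define R where "R = P \<union> (parcs D)\<^sup>* `` {y}"
  have dx: "desc_set D {x, y} = insert x R"
    unfolding desc_set_def R_def P_def using desc_eq_rtrancl xv y
    by (auto simp: rtrancl_eq_or_trancl)
  have dx': "desc_set D {x', y} = insert x' R"
    unfolding desc_set_def R_def P' using desc_eq_rtrancl xv y
    by (auto simp: rtrancl_eq_or_trancl)
  have "lev x < lev z" if "z \<in> P" for z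
    using that unfolding P_def by (auto dest!: tranclD lev_arc reachable_lev)
  then have R: "z = y \<or> lev x < lev z" if "z \<in> R" for z
    using that y reachable_lev[of y z] unfolding R_def by auto
  then have nR: "x \<notin> R" "x' \<notin> R" using ne lx by force+
  have no: "(a, x) \<notin> parcs D" "(a, x') \<notin> parcs D" if "a = x \<or> a = x' \<or> a \<in> R" for a
  proof -
    have "lev x \<le> lev a" using that R[of a] lx y by auto
    then show "(a, x) \<notin> parcs D" "(a, x') \<notin> parcs D"
      using lev_arc[of a x] lev_arc[of a x'] lx by linarith+
  qed
  let ?f = "id(x := x')"
  have "vertex_iso ?f (D \<restriction> desc_set D {x, y}) (D \<restriction> desc_set D {x', y})"
    unfolding vertex_iso_induce_iff dx dx'
  proof
    show "bij_betw ?f (insert x R) (insert x' R)"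
      using nR by (auto simp: bij_betw_def inj_on_def)
    show "\<forall>u\<in>insert x R. \<forall>v\<in>insert x R. (u, v) \<in> parcs D \<longleftrightarrow> (?f u, ?f v) \<in> parcs D"
      using N no by auto
  qed
  moreover have "finite {x, y}" "{x, y} \<subseteq> pverts D" "finite {x', y}" "{x', y} \<subseteq> pverts D"
    using xv y by auto
  ultimately have "\<exists>g. automorphism g D \<and> (\<forall>z\<in>{x, y}. g z = ?f z)"
    using wdh unfolding weakly_descendant_homogeneous_def by metis
  then show thesis using that ne by auto
qed

section \<open>Arcs when the out-neighbours of each vertex are equivalent\<close>

lemma same_level_delta:
  assumes delta_out: "\<forall>u x y. (u, x) \<in> parcs D \<and> (u, y) \<in> parcs D \<longrightarrow> delta D x y"
    and a: "(v, a) \<in> (parcs D)\<^sup>*" and b: "(v, b) \<in> (parcs D)\<^sup>*" and l: "lev a = lev b"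
  shows "delta D a b"
  using a b l
proof (induction arbitrary: b)
  case base
  then show ?case using reachable_lev[of v b] by (auto simp: delta_def)
next
  case (step p a)
  have "lev v < lev a" using reachable_lev[OF step.hyps(1)] lev_arc[OF step.hyps(2)] by auto
  then have "b \<noteq> v" using step.prems by auto
  then obtain q where q: "(v, q) \<in> (parcs D)\<^sup>*" "(q, b) \<in> parcs D"
    using step.prems(1) by (metis rtranclE)
  \<comment> \<open>Both \<open>p\<close> and \<open>q\<close> lie one level below \<open>a\<close>
    and \<open>b\<close>, so the induction hypothesis applies. It turns the edge from
    \<open>q\<close> to \<open>b\<close> into one from \<open>p\<close> to \<open>b\<close>, which
    makes \<open>a\<close> and \<open>b\<close> out-neighbours of \<open>p\<close>.\<close>
  then have "delta D p q"
    using step lev_arc[OF q(2)] lev_arc[OF step.hyps(2)] by auto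
  then have "(p, b) \<in> parcs D" using q by (auto simp: delta_def)
  then show ?case using delta_out step.hyps(2) by blast
qed

lemma s_arcs_same_start:
  assumes delta_out: "\<forall>u x y. (u, x) \<in> parcs D \<and> (u, y) \<in> parcs D \<longrightarrow> delta D x y"
    and wdh: "weakly_descendant_homogeneous D"
    and us: "s_arc D s us" and vs: "s_arc D s vs" and start: "us ! 0 = vs ! 0"
  shows "\<exists>g. automorphism g D \<and> map g us = vs"
proof -
  define v where "v = vs ! 0"
  define V where "V = (parcs D)\<^sup>* `` {v}"
  have usV: "us ! i \<in> V \<and> lev (us ! i) = lev v + int i" if "i \<le> s" for i
    using s_arc_reachable[OF us that] start by (auto simp: V_def v_def)
  have vsV: "vs ! i \<in> V \<and> lev (vs ! i) = lev v + int i" if "i \<le> s" for i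
    using s_arc_reachable[OF vs that] by (auto simp: V_def v_def)
  \<comment> \<open>Levels decide adjacency in \<open>V\<close>: a predecessor of \<open>b\<close>
    in \<open>V\<close> is on the level of \<open>a\<close>, hence has the same out-neighbours as
    \<open>a\<close>.\<close>
  have arc: "(a, b) \<in> parcs D \<longleftrightarrow> lev b = lev a + 1" if ab: "a \<in> V" "b \<in> V" for a b
  proof
    assume l: "lev b = lev a + 1"
    have "b \<noteq> v" using ab reachable_lev[of v a] l by (auto simp: V_def)
    then obtain q where q: "q \<in> V" "(q, b) \<in> parcs D"
      using ab unfolding V_def by (metis Image_singleton_iff rtranclE)
    then have "delta D a q"
      using same_level_delta[OF delta_out, of v a q] ab l lev_arc[OF q(2)] by (auto simp: V_def)
    then show "(a, b) \<in> parcs D" using q by (auto simp: delta_def)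
  qed (rule lev_arc)
  \<comment> \<open>\<open>i x\<close> is the height of \<open>x\<close> above \<open>v\<close>, and
    \<open>nat\<close> truncates nothing on \<open>V\<close>. At each height up to \<open>s\<close>,
    the map \<open>f\<close> swaps the vertices of the two arcs at that height; above
    \<open>s\<close> it is the identity.\<close>
  define i where "i x = nat (lev x - lev v)" for x
  define f where "f x = (if i x \<le> s then Transposition.transpose (us ! i x) (vs ! i x) x else x)" for x
  have iuv: "i (us ! j) = j" "i (vs ! j) = j" if "j \<le> s" for j
    using usV[OF that] vsV[OF that] by (simp_all add: i_def)
  have f: "f x \<in> V \<and> lev (f x) = lev x" if x: "x \<in> V" for x
  proof (cases "i x \<le> s")
    case True
    have "lev v \<le> lev x" using x reachable_lev[of v x] by (auto simp: V_def)
    then have "lev x = lev v + int (i x)" by (simp add: i_def)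
    then show ?thesis using True usV[OF True] vsV[OF True] x
      by (auto simp: f_def Transposition.transpose_def)
  qed (simp add: f_def x)
  \<comment> \<open>Since \<open>f\<close> keeps heights, \<open>f x\<close> and \<open>x\<close>
    are subject to the same transposition, so \<open>f\<close> is an involution.\<close>
  then have "i (f x) = i x" if "x \<in> V" for x using that by (simp add: i_def)
  then have ff: "f (f x) = x" if "x \<in> V" for x
    using that by (simp add: f_def[of "f x"]) (simp add: f_def)
  have "bij_betw f V V"
    by (rule bij_betw_byWitness[where f' = f]) (use f ff in auto)
  moreover have "(a, b) \<in> parcs D \<longleftrightarrow> (f a, f b) \<in> parcs D" if "a \<in> V" "b \<in> V" for a b
    using that f arc by simp
  ultimately have "vertex_iso f (D \<restriction> desc_set D (set us)) (D \<restriction> desc_set D (set vs))"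
    unfolding desc_set_s_arc[OF us] desc_set_s_arc[OF vs] vertex_iso_induce_iff
    using start by (simp add: V_def v_def)
  moreover have "set us \<subseteq> pverts D" "set vs \<subseteq> pverts D" using us vs by (auto simp: s_arc_def)
  ultimately obtain g where g: "automorphism g D" "\<forall>x\<in>set us. g x = f x"
    using wdh unfolding weakly_descendant_homogeneous_def by blast
  have "map g us = vs"
  proof (rule nth_equalityI)
    show "length (map g us) = length vs" using us vs by (simp add: s_arc_def)
    fix j assume "j < length (map g us)"
    then have j: "j \<le> s" "j < length us" using us by (auto simp: s_arc_def)
    then show "map g us ! j = vs ! j" using g(2) iuv by (simp add: f_def)
  qed
  then show ?thesis using g by blast
qed

text \<open>Vertex transitivity moves one arc to the starting vertex of the other, which leaves the
  case of a common start.\<close>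

lemma highly_arc_transitive_if_out_delta:
  assumes delta_out: "\<forall>u x y. (u, x) \<in> parcs D \<and> (u, y) \<in> parcs D \<longrightarrow> delta D x y"
    and wdh: "weakly_descendant_homogeneous D"
  shows "highly_arc_transitive D"
  unfolding highly_arc_transitive_def
proof (intro allI impI, elim conjE)
  fix s us vs assume us: "s_arc D s us" and vs: "s_arc D s vs"
  have "us ! 0 \<in> pverts D" "vs ! 0 \<in> pverts D" using us vs by (auto simp: s_arc_def subset_iff)
  then obtain h where h: "automorphism h D" "h (us ! 0) = vs ! 0"
    using wdh unfolding weakly_descendant_homogeneous_def vertex_transitive_def by blast
  have "map h us ! 0 = vs ! 0" using h us by (simp add: s_arc_def)
  then obtain g where "automorphism g D" "map g (map h us) = vs"
    using s_arcs_same_start[OF delta_out wdh automorphism_map_s_arc[OF h(1) us] vs] by blast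
  then show "\<exists>g. automorphism g D \<and> map g us = vs"
    using automorphism_comp[OF h(1)] by (intro exI[of _ "g \<circ> h"]) simp
qed

section \<open>Alternating walks of length 3 and 5\<close>

lemma reachesI4:
  assumes "(u, x) \<in> parcs D" "(v, x) \<in> parcs D" "(v, y) \<in> parcs D"
  shows "((u, x), (v, y)) \<in> reaches D"
proof -
  \<comment> \<open>Vertices may coincide: \<open>u = v\<close> covers edges with a common tail,
    \<open>x = y\<close> those with a common head, and both together give reflexivity.\<close>
  let ?w = "[u, x, v, y]"
  have "alternating_walk D ?w"
    by (rule alternating_walkI) (use assms arc_verts in \<open>auto simp: less_Suc_eq nth_Cons'\<close>)
  then show ?thesis unfolding reaches_def using assms
    by (auto intro!: exI[of _ ?w] exI[of _ 3])
qed

lemma reachesI6: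
  assumes "(u, x) \<in> parcs D" "(u, y) \<in> parcs D" "(v, y) \<in> parcs D" "(v, z) \<in> parcs D"
  shows "((u, x), (v, z)) \<in> reaches D"
proof -
  \<comment> \<open>The walk has to begin with the edge \<open>(u, x)\<close>, so it returns to
    \<open>u\<close> before leaving along \<open>(u, y)\<close>.\<close>
  let ?w = "[u, x, u, y, v, z]"
  have "alternating_walk D ?w"
    by (rule alternating_walkI) (use assms arc_verts in \<open>auto simp: less_Suc_eq nth_Cons'\<close>)
  then show ?thesis unfolding reaches_def using assms
    by (auto intro!: exI[of _ ?w] exI[of _ 5])
qed

end

section \<open>Transferring sizes from \<open>\<Sigma>\<close> to alternets and to
  \<open>D\<close>\<close>

lemma class_C_parts:
  assumes "\<Sigma> \<in> class_C"
  shows "finite (snd ` parcs \<Sigma>)"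
    "u \<in> fst ` parcs \<Sigma> \<Longrightarrow> card {v \<in> fst ` parcs \<Sigma>. delta \<Sigma> u v} = card (snd ` parcs \<Sigma>)"
proof -
  obtain X Y where XY: "pverts \<Sigma> = X \<union> Y" "X \<inter> Y = {}" "parcs \<Sigma> \<subseteq> X \<times> Y" "finite X" "finite Y"
      "\<forall>u\<in>X. card {v \<in> X. delta \<Sigma> u v} = card Y"
    and iso: "\<forall>v\<in>pverts \<Sigma>. \<exists>e\<in>parcs \<Sigma>. v = fst e \<or> v = snd e"
    using assms unfolding class_C_def by blast
  \<comment> \<open>No vertex is isolated and all edges go from \<open>X\<close> to
    \<open>Y\<close>, so the edges determine both parts.\<close>
  have "X = fst ` parcs \<Sigma>" "Y = snd ` parcs \<Sigma>"
    using XY(1-3) iso by (fastforce simp: image_iff)+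
  then show "finite (snd ` parcs \<Sigma>)"
    "u \<in> fst ` parcs \<Sigma> \<Longrightarrow> card {v \<in> fst ` parcs \<Sigma>. delta \<Sigma> u v} = card (snd ` parcs \<Sigma>)"
    using XY by auto
qed

text \<open>By property Z the subdigraph induced on the ends of \<open>A\<close> has no edges
  besides \<open>A\<close>. An isomorphism with \<open>\<Sigma>\<close> therefore carries
  \<open>A\<close> onto all edges of \<open>\<Sigma>\<close>, and the counting can be done with
  plain relations.\<close>

lemma alternet_iso:
  fixes D :: "'a pair_pre_digraph" and \<Sigma> :: "'b pair_pre_digraph"
  assumes D: "pair_wf_digraph D" and Z: "property_Z D" and S: "pair_wf_digraph \<Sigma>"
    and A: "A \<in> parcs D // reaches D"
    and alt: "\<forall>A\<in>alternets D. digraph_iso A \<Sigma>"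
  obtains h where "inj_on h (fst ` A \<union> snd ` A)" "parcs \<Sigma> = map_prod h h ` A"
proof -
  interpret D: pair_wf_digraph D by fact
  interpret S: pair_wf_digraph \<Sigma> by fact
  let ?V = "fst ` A \<union> snd ` A"
  have arcs: "arcs (D \<restriction> ?V) = A" using arcs_alternet[OF D Z A] .
  have G: "nomulti_digraph (D \<restriction> ?V)"
    by unfold_locales (auto simp: induce_subgraph_def arc_to_ends_def)
  have H: "nomulti_digraph \<Sigma>"
    by unfold_locales (auto simp: arc_to_ends_def)
  have "digraph_iso (D \<restriction> ?V) \<Sigma>" using alt A unfolding alternets_def by blast
  then obtain h where h: "vertex_iso h (D \<restriction> ?V) \<Sigma>"
    using digraph_iso_iff_vertex_iso[OF G H] by blast
  have dom: "u \<rightarrow>\<^bsub>D \<restriction> ?V\<^esub> v \<longleftrightarrow> (u, v) \<in> A" for u v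
    using arcs by (auto simp: arcs_ends_conv induce_subgraph_def)
  have bij: "bij_betw h ?V (pverts \<Sigma>)"
    and e: "\<And>u v. u \<in> ?V \<Longrightarrow> v \<in> ?V \<Longrightarrow> (u, v) \<in> A \<longleftrightarrow> (h u, h v) \<in> parcs \<Sigma>"
    using h unfolding vertex_iso_def dom by (auto simp: arcs_ends_conv)
  have "parcs \<Sigma> \<subseteq> map_prod h h ` A"
  proof
    fix p assume p: "p \<in> parcs \<Sigma>"
    then have "fst p \<in> h ` ?V" "snd p \<in> h ` ?V"
      using S.wellformed' bij by (metis bij_betw_imp_surj_on prod.collapse)+
    then obtain a b where ab: "a \<in> ?V" "b \<in> ?V" "p = (h a, h b)"
      by (cases p) auto
    then have "(a, b) \<in> A" using e p by blast
    then show "p \<in> map_prod h h ` A" using ab by force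
  qed
  moreover have "map_prod h h ` A \<subseteq> parcs \<Sigma>"
    using e by (force simp: image_iff)
  ultimately show thesis using that bij by (auto simp: bij_betw_def)
qed

lemma card_sinks:
  assumes inj: "inj_on h (fst ` A \<union> snd ` A)" and S: "S = map_prod h h ` A"
  shows "card (snd ` S) = card (snd ` A)" "finite (snd ` S) \<Longrightarrow> finite (snd ` A)"
proof -
  have im: "snd ` S = h ` (snd ` A)" unfolding S by (simp add: image_image)
  have inj': "inj_on h (snd ` A)" using inj by (auto intro: inj_on_subset)
  show "card (snd ` S) = card (snd ` A)" unfolding im by (rule card_image[OF inj'])
  show "finite (snd ` A)" if "finite (snd ` S)" using that inj' unfolding im by (rule finite_imageD)
qed

text \<open>\<open>h\<close> maps out-neighbourhoods onto out-neighbourhoods, and by injectivity it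
  preserves and reflects their equality.\<close>

lemma card_source_class:
  assumes inj: "inj_on h (fst ` A \<union> snd ` A)" and S: "S = map_prod h h ` A" and x: "x \<in> fst ` A"
  shows "card {x' \<in> fst ` A. A `` {x'} = A `` {x}} = card {v \<in> fst ` S. S `` {h x} = S `` {v}}"
proof -
  have im: "fst ` S = h ` (fst ` A)" unfolding S by (simp add: image_image)
  have inj': "inj_on h (fst ` A)" using inj by (auto intro: inj_on_subset)
  have out: "S `` {h a} = h ` (A `` {a})" if a: "a \<in> fst ` A" for a
  proof -
    \<comment> \<open>No tail other than \<open>a\<close> contributes to the out-neighbours of
      \<open>h a\<close>.\<close>
    have "b = a" if "(b, c) \<in> A" "h b = h a" for b c
      using inj_onD[OF inj' that(2)] that(1) a by force
    then show ?thesis unfolding S by (force simp: image_iff)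
  qed
  have eq: "S `` {h x} = S `` {h a} \<longleftrightarrow> A `` {a} = A `` {x}" if a: "a \<in> fst ` A" for a
  proof -
    have "A `` {x} \<subseteq> fst ` A \<union> snd ` A" "A `` {a} \<subseteq> fst ` A \<union> snd ` A" by force+
    then show ?thesis unfolding out[OF a] out[OF x] using inj_on_image_eq_iff[OF inj] by auto
  qed
  have "{v \<in> fst ` S. S `` {h x} = S `` {v}} = h ` {x' \<in> fst ` A. A `` {x'} = A `` {x}}"
    unfolding im using eq by blast
  moreover have "inj_on h {x' \<in> fst ` A. A `` {x'} = A `` {x}}"
    using inj' by (rule inj_on_subset) auto
  ultimately show ?thesis by (simp add: card_image)
qed

text \<open>\<open>A\<close> contains all edges from \<open>x\<close>, and all edges from an
  equivalent vertex, which shares the head \<open>w\<close>. Conversely, agreement inside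
  \<open>A\<close> gives an inclusion of out-neighbourhoods in \<open>D\<close>, and constant finite
  valency makes it an equality.\<close>

lemma (in levelled_digraph) delta_class_eq:
  assumes out: "\<And>v. v \<in> pverts D \<Longrightarrow> card (parcs D `` {v}) = m" and m: "m > 0"
    and w: "(x, w) \<in> parcs D" and A: "A = reaches D `` {(x, w)}"
  shows "{x' \<in> pverts D. delta D x x'} = {x' \<in> fst ` A. A `` {x'} = A `` {x}}"
proof -
  have AD: "A \<subseteq> parcs D" unfolding A reaches_def by auto
  have Ax: "A `` {x} = parcs D `` {x}"
    using AD reachesI4[OF w w] unfolding A by auto
  show ?thesis
  proof (intro set_eqI iffI; clarsimp simp only: mem_Collect_eq)
    fix x' assume "delta D x x'"
    then have N: "parcs D `` {x'} = parcs D `` {x}" by (simp add: delta_def)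
    then have w': "(x', w) \<in> parcs D" using w by blast
    then have "A `` {x'} = parcs D `` {x'}"
      using AD reachesI4[OF w w'] unfolding A by auto
    moreover have "(x', w) \<in> A" using reachesI4[OF w w' w'] unfolding A by auto
    ultimately show "x' \<in> fst ` A \<and> A `` {x'} = A `` {x}" using Ax N by force
  next
    fix a b assume ab: "(a, b) \<in> A" and e: "A `` {fst (a, b)} = A `` {x}"
    have a: "a \<in> pverts D" using ab AD arc_verts by blast
    have "parcs D `` {x} \<subseteq> parcs D `` {a}" using e Ax AD by auto
    moreover have "card (parcs D `` {x}) = card (parcs D `` {a})"
      using out a arc_verts[OF w] by simp
    \<comment> \<open>\<open>card\<close> is 0 on infinite sets, so positive valency yields
      finiteness.\<close>
    moreover have "finite (parcs D `` {a})" using out[OF a] m by (simp add: card_ge_0_finite)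
    ultimately have "parcs D `` {x} = parcs D `` {a}" by (simp add: card_subset_eq)
    then show "fst (a, b) \<in> pverts D \<and> delta D x (fst (a, b))" using a by (simp add: delta_def)
  qed
qed

lemma card_out_neighbours:
  "card (parcs D `` {v}) = out_degree D v" for D :: "'a pair_pre_digraph"
proof -
  have "out_arcs D v = Pair v ` (parcs D `` {v})" by (auto simp: out_arcs_def)
  then show ?thesis by (simp add: out_degree_def card_image inj_on_def)
qed

section \<open>Counting sinks against equivalence classes\<close>

theorem theorem5p11:
  fixes D :: "'a pair_pre_digraph" and \<Sigma> :: "'b pair_pre_digraph" and m :: nat
  assumes "pair_loopfree_digraph D"
    and "infinite (pverts D)"
    and "connected D"
    and "edge_transitive D"
    and "weakly_descendant_homogeneous D"
    and "m > 1"
    and "\<forall>v\<in>pverts D. out_degree D v = m"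
    and "property_Z D"
    and "\<Sigma> \<in> class_C"
    and "\<forall>A\<in>alternets D. digraph_iso A \<Sigma>"
  shows "highly_arc_transitive D"
proof -
  interpret D: pair_loopfree_digraph D by fact
  have D: "pair_wf_digraph D" by unfold_locales
  have S: "pair_wf_digraph \<Sigma>"
    using assms(9) unfolding class_C_def by (auto simp: pair_loopfree_digraph_def)
  obtain lev :: "'a \<Rightarrow> int" where lev: "\<forall>(u, v)\<in>parcs D. lev v = lev u + 1"
    using assms(8) unfolding property_Z_def by (elim exE conjE) (rule that)
  interpret levelled_digraph D lev by unfold_locales (use lev in auto)
  have out: "card (parcs D `` {v}) = m" if "v \<in> pverts D" for v
    using that assms(7) by (simp add: card_out_neighbours)
  \<comment> \<open>The class of \<open>x\<close> in \<open>D\<close> is its class among the sources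
    of the alternet of \<open>(x, w)\<close>. That one corresponds to a class in
    \<open>\<Sigma>\<close>, whose size is the number of sinks by membership in
    \<open>class_C\<close>.\<close>
  have class_size: "card {x' \<in> pverts D. delta D x x'} = card (snd ` parcs \<Sigma>)"
    if w: "(x, w) \<in> parcs D" for x w
  proof -
    define A where "A = reaches D `` {(x, w)}"
    have "A \<in> parcs D // reaches D" using w by (simp add: A_def quotientI)
    then obtain h where h: "inj_on h (fst ` A \<union> snd ` A)" "parcs \<Sigma> = map_prod h h ` A"
      using alternet_iso[OF D assms(8) S _ assms(10)] by blast
    have "(x, w) \<in> A" using reachesI4[OF w w w] by (simp add: A_def)
    then have x: "x \<in> fst ` A" "h x \<in> fst ` parcs \<Sigma>" unfolding h(2) by force+
    show ?thesis
      using delta_class_eq[OF out _ w A_def] card_source_class[OF h x(1)] assms(6)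
        class_C_parts(2)[OF assms(9) x(2)] by (simp add: delta_def)
  qed
  have "delta D x y" if x: "(u, x) \<in> parcs D" and y: "(u, y) \<in> parcs D" and ne: "x \<noteq> y" for u x y
  proof -
    define A where "A = reaches D `` {(u, x)}"
    have "A \<in> parcs D // reaches D" using x by (simp add: A_def quotientI)
    then obtain h where h: "inj_on h (fst ` A \<union> snd ` A)" "parcs \<Sigma> = map_prod h h ` A"
      using alternet_iso[OF D assms(8) S _ assms(10)] by blast
    \<comment> \<open>An edge leaving \<open>x\<close> is required both by the exchange and by
      \<open>class_size\<close>.\<close>
    have "parcs D `` {x} \<noteq> {}" using out[of x] arc_verts[OF x] assms(6) by force
    then obtain w where w: "(x, w) \<in> parcs D" by blast
    have yA: "(u, y) \<in> A" using reachesI4[OF x x y] by (simp add: A_def)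
    have "{x' \<in> pverts D. delta D x x'} \<subseteq> snd ` A"
    proof clarify
      fix x' assume d: "delta D x x'"
      show "x' \<in> snd ` A"
      proof (cases "x' = y")
        case True
        then show ?thesis using yA by force
      next
        case False
        have "lev y = lev x" using lev_arc[OF x] lev_arc[OF y] by simp
        then obtain g where g: "automorphism g D" "g x = x'" "g y = y"
          using delta_exchange[OF assms(5) d w _ _ ne False] arc_verts[OF y] by blast
        then have "(g u, y) \<in> parcs D" "(g u, x') \<in> parcs D"
          using x y arc_verts unfolding automorphism_iff by metis+
        \<comment> \<open>As \<open>g\<close> fixes \<open>y\<close>, the vertex \<open>y\<close>
          links the two stars: the walk is \<open>u\<close>, \<open>x\<close>, \<open>u\<close>,
          \<open>y\<close>, \<open>g u\<close>, \<open>x'\<close>.\<close>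
        then have "(g u, x') \<in> A" using reachesI6[OF x y] by (simp add: A_def)
        then show ?thesis by force
      qed
    qed
    \<comment> \<open>\<open>A\<close> has as many sinks as \<open>\<Sigma>\<close>, which is also
      the size of the class of \<open>x\<close>. The inclusion is thus an equality, and the sink
      \<open>y\<close> belongs to that class.\<close>
    moreover have "finite (snd ` A)" "card (snd ` A) = card {x' \<in> pverts D. delta D x x'}"
      using card_sinks[OF h] class_C_parts(1)[OF assms(9)] class_size[OF w] by simp_all
    ultimately have "{x' \<in> pverts D. delta D x x'} = snd ` A" by (simp add: card_subset_eq)
    then show ?thesis using yA by force
  qed
  moreover have "delta D x x" for x by (simp add: delta_def)
  ultimately have "\<forall>u x y. (u, x) \<in> parcs D \<and> (u, y) \<in> parcs D \<longrightarrow> delta D x y" by metis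
  then show ?thesis using highly_arc_transitive_if_out_delta assms(5) by blast
qed

end
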